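(* Let $f:\mathbb{R}^n\to\mathbb{R}$, $x^0\in\mathbb{R}^n$, $S=[s^1\cdots s^p]\in\mathbb{R}^{n\times p}$, and $T_i=[t_i^1\cdots t_i^{q_i}]\in\mathbb{R}^{n\times q_i}$ for $i=1,\ldots,p$, with $T_{1:p}=\{T_1,\ldots,T_p\}$. Let $$Y=\{x^0\}\cup\{x^0+s^i:1\le i\le p\}\cup\{x^0+t_i^j:1\le i\le p,\,1\le j\le q_i\}\cup\{x^0+s^i+t_i^j:1\le i\le p,\,1\le j\le q_i\}.$$ Suppose that $Y$ lies in the $d$-dimensional affine space $\mathcal{Y}=\{x^0+Q\widehat{x}:\widehat{x}\in\mathbb{R}^d\}$, where $d<n$ and $Q\in\mathbb{R}^{n\times d}$ has $d$ orthonormal columns, and let $\widehat{f}(\widehat{x})=f(x^0+Q\widehat{x})$ for $\widehat{x}\in\mathbb{R}^d$. Then there exist $\widehat{S}=[\widehat{s}^1\cdots\widehat{s}^p]\in\mathbb{R}^{d\times p}$ and $\widehat{T}_i=[\widehat{t}_i^1\cdots\widehat{t}_i^{q_i}]\in\mathbb{R}^{d\times q_i}$, $i=1,\ldots,p$, such that $S=Q\widehat{S}$ and $T_i=Q\widehat{T}_i$ for $i=1,\ldots,p$. Writing $\widehat{T}_{1:p}=\{\widehat{T}_1,\ldots,\widehat{T}_p\}$, the generalized simplex Hessian of $f$ at $x^0$ over $S$ and $T_{1:p}$ and the generalized simplex Hessian of $\widehat{f}$ at $0$ over $\widehat{S}$ and $\widehat{T}_{1:p}$ satisfy $$\nabl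a_s^2f(x^0;S;T_{1:p})=Q\nabla_s^2\widehat{f}(0;\widehat{S};\widehat{T}_{1:p})Q^\top.$$
   Context: $A^\dagger$ denotes the Moore–Penrose pseudoinverse of a matrix $A$. The collections $T_{1:p}$, $\widehat{T}_{1:p}$ are indexed families (the $i$-th matrix is paired with the $i$-th column of $S$, resp. $\widehat{S}$). Generalized simplex gradient (GSG). For $g:\mathbb{R}^k\to\mathbb{R}$, $z^0\in\mathbb{R}^k$ and $A=[a^1\cdots a^q]\in\mathbb{R}^{k\times q}$, $$\nabla_sg(z^0;A)=(A^\top)^\dagger\begin{bmatrix}g(z^0+a^1)-g(z^0)\\ \vdots\\ g(z^0+a^q)-g(z^0)\end{bmatrix}\in\mathbb{R}^k.$$ Generalized simplex Hessian (GSH). For $g:\mathbb{R}^k\to\mathbb{R}$, $z^0\in\mathbb{R}^k$, $A=[a^1\cdots a^p]\in\mathbb{R}^{k\times p}$ and $B_i\in\mathbb{R}^{k\times q_i}$, $i=1,\ldots,p$, $$\nabla_s^2g(z^0;A;B_{1:p})=(A^\top)^\dagger\,\delta_g^2(z^0;A;B_{1:p})\in\mathbb{R}^{k\times k},\qquad \delta_g^2(z^0;A;B_{1:p})=\begin{bmatrix}\left(\nabla_sg(z^0+a^1;B_1)-\nabla_sg(z^0;B_1)\right)^\top\\ \vdots\\ \left(\nabla_sg(z^0+a^p;B_p)-\nabla_sg(z^0;B_p)\right)^\top\end{bmatrix}\in\mathbb{R}^{p\times k}.$$ *)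

theory Defs
  imports Complex_Main "Jordan_Normal_Form.Matrix"
begin

definition is_pinv :: "real mat \<Rightarrow> real mat \<Rightarrow> bool" where
  "is_pinv A X \<longleftrightarrow>
     X \<in> carrier_mat (dim_col A) (dim_row A) \<and>
     A * X * A = A \<and> X * A * X = X \<and>
     transpose_mat (A * X) = A * X \<and> transpose_mat (X * A) = X * A"

(* The Penrose conditions have exactly one solution for every real matrix,
   so the definite description is well defined. *)
definition pinv :: "real mat \<Rightarrow> real mat" where
  "pinv A = (THE X. is_pinv A X)"

(* Columns are indexed from 0: col A j is the (j+1)-st column. A function on R^k is a function
   on the type of vectors of all dimensions, of which only the values on carrier_vec k matter. *)
definition simplex_gradient :: "(real vec \<Rightarrow> real) \<Rightarrow> real vec \<Rightarrow> real mat \<Rightarrow> real vec" where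
  "simplex_gradient g z A =
     pinv (transpose_mat A) *\<^sub>v vec (dim_col A) (\<lambda>j. g (z + col A j) - g z)"

(* mat_of_row_fun m k r is the m x k matrix with rows r 0, ..., r (m - 1). *)
definition simplex_delta2 ::
  "(real vec \<Rightarrow> real) \<Rightarrow> real vec \<Rightarrow> real mat \<Rightarrow> (nat \<Rightarrow> real mat) \<Rightarrow> real mat" where
  "simplex_delta2 g z A B =
     mat_of_row_fun (dim_col A) (dim_row A)
       (\<lambda>i. simplex_gradient g (z + col A i) (B i) - simplex_gradient g z (B i))"

definition simplex_hessian ::
  "(real vec \<Rightarrow> real) \<Rightarrow> real vec \<Rightarrow> real mat \<Rightarrow> (nat \<Rightarrow> real mat) \<Rightarrow> real mat" where
  "simplex_hessian g z A B = pinv (transpose_mat A) * simplex_delta2 g z A B"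

end

(* For Q with orthonormal columns, the Penrose conditions give pinv (A * Q^T) = Q * pinv A.
   Each gradient of f therefore is Q times the corresponding gradient of fhat, the second
   difference matrices differ by a right factor Q^T, and the Hessian acquires the factors Q, Q^T.
   Existence of the pseudoinverse is obtained from inner inverses (A * Z * A = A) by cancellation. *)
theory Submission
  imports Defs
begin

section \<open>Existence and uniqueness of the Moore-Penrose pseudoinverse\<close>

text \<open>The diagonal entry at \<open>(j, j)\<close> of the product is the sum of the squares of
  column \<open>j\<close> of \<open>C\<close>; over the reals it vanishes only if the column
  does.\<close>

lemma transpose_mult_self_zero:
  fixes C :: "real mat"
  assumes C: "C \<in> carrier_mat m n" and zero: "transpose_mat C * C = 0\<^sub>m n n"
  shows "C = 0\<^sub>m m n"
proof (rule eq_matI)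
  fix i j assume ij: "i < dim_row (0\<^sub>m m n :: real mat)" "j < dim_col (0\<^sub>m m n :: real mat)"
  have "(\<Sum>k<m. (C $$ (k, j))\<^sup>2) = (transpose_mat C * C) $$ (j, j)"
    using C ij by (auto simp: scalar_prod_def power2_eq_square atLeast0LessThan)
  also have "\<dots> = 0"
    using zero ij by simp
  finally have "(C $$ (i, j))\<^sup>2 = 0"
    using ij by (subst (asm) sum_nonneg_eq_0_iff) auto
  then show "C $$ (i, j) = 0\<^sub>m m n $$ (i, j)"
    using ij by simp
qed (use C in auto)

lemma minus_mat_eq_zero_iff:
  fixes A B :: "'a :: group_add mat"
  assumes "A \<in> carrier_mat m n" "B \<in> carrier_mat m n"
  shows "A - B = 0\<^sub>m m n \<longleftrightarrow> A = B"
proof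
  assume *: "A - B = 0\<^sub>m m n"
  show "A = B"
  proof (rule eq_matI)
    fix i j assume "i < dim_row B" "j < dim_col B"
    then have "(A - B) $$ (i, j) = 0"
      using * assms by simp
    then show "A $$ (i, j) = B $$ (i, j)"
      using \<open>i < dim_row B\<close> \<open>j < dim_col B\<close> by simp
  qed (use assms in auto)
qed (use assms in auto)

text \<open>McCoy's lemma: adding \<open>A * X * A\<close> does not affect the existence of an inner inverse.\<close>

lemma inner_inverse_mccoy:
  fixes A :: "'a :: comm_ring_1 mat"
  assumes A: "A \<in> carrier_mat m n" and X: "X \<in> carrier_mat n m" and Y: "Y \<in> carrier_mat n m"
    and inner: "(A - A * X * A) * Y * (A - A * X * A) = A - A * X * A"
  shows "\<exists>Z \<in> carrier_mat n m. A * Z * A = A"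
proof -
  \<comment> \<open>Both \<open>L * A\<close> and \<open>A * R\<close> equal the residual
    \<open>A - A * X * A\<close>. Hence the correction \<open>R * Y * L\<close>, placed between two
    factors \<open>A\<close>, contributes exactly what \<open>X\<close> misses.\<close>
  define L where "L = 1\<^sub>m m - A * X"
  define R where "R = 1\<^sub>m n - X * A"
  define Z where "Z = X + R * Y * L"
  have L: "L \<in> carrier_mat m m" and R: "R \<in> carrier_mat n n"
    and Z: "Z \<in> carrier_mat n m"
    using A X Y by (auto simp: L_def R_def Z_def)
  have LA: "L * A = A - A * X * A"
    using A X by (simp add: L_def minus_mult_distrib_mat[of _ m m _ _ n])
  have AR: "A * R = A - A * X * A"
    using A X by (simp add: R_def mult_minus_distrib_mat[of _ m n _ n])
  have "A * Z * A = A * X * A + A * (R * Y * L) * A"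
    using A X Y L R
    by (simp add: Z_def mult_add_distrib_mat[of _ m n _ m] add_mult_distrib_mat[of _ m m _ _ n])
  also have "A * (R * Y * L) * A = (A * R) * Y * (L * A)"
    using A Y L R
    by (simp add: assoc_mult_mat[of _ m n _ m _ n] assoc_mult_mat[of _ m m _ n _ n]
      assoc_mult_mat[of _ n m _ m _ n] assoc_mult_mat[of _ n n _ m _ n])
  also have "\<dots> = A - A * X * A"
    unfolding LA AR by (rule inner)
  also have "A * X * A + (A - A * X * A) = A"
    using A X by (intro eq_matI) auto
  finally show ?thesis
    using Z by blast
qed


text \<open>By McCoy's lemma, subtracting \<open>A * X * A\<close> with \<open>X = E\<^sub>j\<^sub>i / A\<^sub>i\<^sub>j\<close> for a nonzero
  entry \<open>A\<^sub>i\<^sub>j\<close> reduces to a matrix with fewer nonzero rows.\<close>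

lemma inner_inverse_exists:
  fixes A :: "'a :: field mat"
  assumes "A \<in> carrier_mat m n"
  shows "\<exists>Z \<in> carrier_mat n m. A * Z * A = A"
  using assms
proof (induction "card {i. i < m \<and> row A i \<noteq> 0\<^sub>v n}" arbitrary: A rule: less_induct)
  case less
  note A = \<open>A \<in> carrier_mat m n\<close>
  show ?case
  proof (cases "A = 0\<^sub>m m n")
    case True
    then show ?thesis
      by (intro bexI[of _ "0\<^sub>m n m"]) auto
  next
    case False
    then obtain i j where ij: "i < m" "j < n" and nz: "A $$ (i, j) \<noteq> 0"
      using A by (metis carrier_matD eq_matI index_zero_mat)
    define X where "X = mat n m (\<lambda>(k, l). if k = j \<and> l = i then 1 / A $$ (i, j) else 0)"
    define B where "B = A - A * X * A"
    have X: "X \<in> carrier_mat n m" and B: "B \<in> carrier_mat m n"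
      using A by (auto simp: X_def B_def)
    have AX: "(A * X) $$ (k, l) = (if l = i then A $$ (k, j) / A $$ (i, j) else 0)"
      if "k < m" "l < m" for k l
    proof -
      have "(A * X) $$ (k, l) = (\<Sum>h<n. A $$ (k, h) * X $$ (h, l))"
        using A X that by (simp add: scalar_prod_def atLeast0LessThan)
      also have "\<dots> = (\<Sum>h<n. if h = j then (if l = i then A $$ (k, j) / A $$ (i, j) else 0) else 0)"
        using that by (intro sum.cong) (auto simp: X_def)
      finally show ?thesis
        using ij by simp
    qed
    \<comment> \<open>This is Gaussian elimination with pivot \<open>(i, j)\<close>: a multiple of
      row \<open>i\<close> is subtracted from every row, including row \<open>i\<close> itself. Row
      \<open>i\<close> becomes zero, and rows that were zero stay zero.\<close>
    have B_entry: "B $$ (k, l) = A $$ (k, l) - A $$ (k, j) / A $$ (i, j) * A $$ (i, l)"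
      if "k < m" "l < n" for k l
    proof -
      have "(A * X * A) $$ (k, l) = (\<Sum>h<m. (A * X) $$ (k, h) * A $$ (h, l))"
        using A X that by (simp add: scalar_prod_def atLeast0LessThan del: assoc_mult_mat)
      also have "\<dots> = (\<Sum>h<m. if h = i then A $$ (k, j) / A $$ (i, j) * A $$ (i, l) else 0)"
        using that by (intro sum.cong) (auto simp: AX simp del: index_mult_mat)
      finally show ?thesis
        using ij A X that by (simp add: B_def del: assoc_mult_mat)
    qed
    have "{k. k < m \<and> row B k \<noteq> 0\<^sub>v n} \<subseteq> {k. k < m \<and> row A k \<noteq> 0\<^sub>v n} - {i}"
    proof (intro subsetI, clarsimp, intro conjI notI)
      fix k assume k: "k < m" and neq: "row B k \<noteq> 0\<^sub>v n"
      show False if "row A k = 0\<^sub>v n"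
      proof -
        have "A $$ (k, l) = 0" if "l < n" for l
          using that \<open>row A k = 0\<^sub>v n\<close> A k by (metis carrier_matD index_row(1) index_zero_vec(1))
        then show False
          using neq B k ij by (auto simp: B_entry intro!: eq_vecI)
      qed
      show False if "k = i"
        using that neq B k nz by (auto simp: B_entry intro!: eq_vecI)
    qed
    moreover have "row A i \<noteq> 0\<^sub>v n"
      using ij nz A by (metis carrier_matD index_row(1) index_zero_vec(1))
    ultimately have "{k. k < m \<and> row B k \<noteq> 0\<^sub>v n} \<subset> {k. k < m \<and> row A k \<noteq> 0\<^sub>v n}"
      using ij by blast
    then have "card {k. k < m \<and> row B k \<noteq> 0\<^sub>v n} < card {k. k < m \<and> row A k \<noteq> 0\<^sub>v n}"
      by (intro psubset_card_mono) auto
    from less.hyps[OF this B] obtain Y where "Y \<in> carrier_mat n m" "B * Y * B = B"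
      by blast
    then show ?thesis
      using inner_inverse_mccoy[OF A X] by (simp add: B_def)
  qed
qed

text \<open>\<open>G = Y * A\<^sup>T\<close>, where \<open>Y\<close> is an inner inverse of \<open>M = A\<^sup>T * A\<close>.  The step from
  \<open>M * Y * M = M\<close> to \<open>A * Y * M = A\<close> cancels \<open>A\<^sup>T\<close>, since \<open>C\<^sup>T * C = 0\<close> implies \<open>C = 0\<close>.\<close>

lemma least_squares_inverse_exists:
  fixes A :: "real mat"
  assumes A: "A \<in> carrier_mat m n"
  shows "\<exists>G \<in> carrier_mat n m. A * G * A = A \<and> transpose_mat (A * G) = A * G"
proof -
  define M where "M = transpose_mat A * A"
  have M: "M \<in> carrier_mat n n"
    using A by (simp add: M_def)
  have Mt: "transpose_mat M = M"
    using A by (simp add: M_def transpose_mult[of _ n m])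
  obtain Y where Y: "Y \<in> carrier_mat n n" and MYM: "M * Y * M = M"
    using inner_inverse_exists[OF M] by blast
  \<comment> \<open>Stated for arbitrary \<open>Z\<close> because both \<open>Y\<close> and its
    transpose are needed: \<open>M\<close> is symmetric, but \<open>Y\<close> need not be.\<close>
  have cancel: "A * Z * M = A" if Z: "Z \<in> carrier_mat n n" and MZM: "M * Z * M = M" for Z
  proof -
    define C where "C = A * Z * M - A"
    have C: "C \<in> carrier_mat m n"
      using A by (simp add: C_def minus_carrier_mat)
    have AC: "transpose_mat A * C = 0\<^sub>m n n"
    proof -
      have "transpose_mat A * C = transpose_mat A * (A * Z * M) - M"
        unfolding C_def M_def using A Z by (intro mult_minus_distrib_mat[of _ n m _ n]) auto
      also have "transpose_mat A * (A * Z * M) = M * Z * M"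
        using A M Z by (simp add: M_def assoc_mult_mat[of _ n m _ n _ n])
      finally show ?thesis
        using M MZM by simp
    qed
    \<comment> \<open>Writing \<open>C\<close> as \<open>A * W\<close> makes
      \<open>transpose_mat A\<close> a factor of \<open>transpose_mat C\<close>, so that
      \<open>AC\<close> annihilates \<open>transpose_mat C * C\<close>.\<close>
    define W where "W = Z * M - 1\<^sub>m n"
    have W: "W \<in> carrier_mat n n"
      by (simp add: W_def minus_carrier_mat)
    have CW: "C = A * W"
      using A M Z by (simp add: C_def W_def mult_minus_distrib_mat[of _ m n _ n])
    have "transpose_mat C = transpose_mat W * transpose_mat A"
      unfolding CW by (rule transpose_mult[OF A W])
    then have "transpose_mat C * C = transpose_mat W * (transpose_mat A * C)"
      using A W C by (simp add: assoc_mult_mat[of _ n n _ m _ n])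
    also have "\<dots> = 0\<^sub>m n n"
      using W unfolding AC by simp
    finally have "C = 0\<^sub>m m n"
      by (rule transpose_mult_self_zero[OF C])
    then show ?thesis
      using A M Z minus_mat_eq_zero_iff[of "A * Z * M" m n A] by (simp add: C_def)
  qed
  define Yt where "Yt = transpose_mat Y"
  have Yt: "Yt \<in> carrier_mat n n"
    using Y by (simp add: Yt_def)
  have "M * Yt * M = transpose_mat (M * Y * M)"
    using M Y Mt by (simp add: Yt_def transpose_mult[of _ n n _ n])
  then have "M * Yt * M = M"
    by (simp add: MYM Mt)
  then have AYtM: "A * Yt * M = A"
    by (rule cancel[OF Yt])
  define P where "P = A * (Y * transpose_mat A)"
  have P: "P \<in> carrier_mat m m"
    using A Y by (simp add: P_def)
  have Pt: "transpose_mat P = A * Yt * transpose_mat A"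
    using A Y by (simp add: P_def Yt_def transpose_mult[of _ m n _ m] transpose_mult[of _ n n _ m])
  \<comment> \<open>The aim is \<open>transpose_mat P * P = P\<close>: its left side is its own
    transpose, so \<open>P\<close> is symmetric.\<close>
  have "transpose_mat P * P = (A * Yt * M) * (Y * transpose_mat A)"
    unfolding Pt using A Y Yt
    by (simp add: P_def M_def assoc_mult_mat[of _ n m _ n _ m] assoc_mult_mat[of _ m n _ m _ m]
      assoc_mult_mat[of _ m n _ n _ m] assoc_mult_mat[of _ n n _ m _ m])
  also have "\<dots> = P"
    by (simp only: AYtM P_def)
  finally have PtP: "transpose_mat P * P = P" .
  then have "transpose_mat P = transpose_mat (transpose_mat P * P)"
    by simp
  also have "\<dots> = transpose_mat P * P"
    using P by (simp add: transpose_mult[of _ m m _ m])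
  finally have "transpose_mat P = P"
    using PtP by simp
  moreover have "P * A = A"
    using cancel[OF Y MYM] A Y by (simp add: P_def M_def assoc_mult_mat[of _ m n _ m _ n]
      assoc_mult_mat[of _ m n _ n _ n] assoc_mult_mat[of _ n n _ m _ n])
  ultimately show ?thesis
    using A Y by (intro bexI[of _ "Y * transpose_mat A"]) (auto simp: P_def)
qed

text \<open>Urquhart's formula: combine a \<open>{1,4}\<close>-inverse \<open>K\<close> and a \<open>{1,3}\<close>-inverse \<open>G\<close> into \<open>K * A * G\<close>.\<close>

lemma is_pinv_exists: "\<exists>X. is_pinv A X"
proof -
  define m where "m = dim_row A"
  define n where "n = dim_col A"
  have A: "A \<in> carrier_mat m n"
    by (simp add: m_def n_def)
  obtain G where G: "G \<in> carrier_mat n m" and AGA: "A * G * A = A"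
    and sym_AG: "transpose_mat (A * G) = A * G"
    using least_squares_inverse_exists[OF A] by blast
  \<comment> \<open>A least-squares inverse of the transpose, transposed back, is an inner inverse
    \<open>K\<close> of \<open>A\<close> for which \<open>K * A\<close> is symmetric.\<close>
  obtain H where H: "H \<in> carrier_mat m n"
    and AHA: "transpose_mat A * H * transpose_mat A = transpose_mat A"
    and sym_AH: "transpose_mat (transpose_mat A * H) = transpose_mat A * H"
    using least_squares_inverse_exists[of "transpose_mat A" n m] A by auto
  define K where "K = transpose_mat H"
  have K: "K \<in> carrier_mat n m"
    using H by (simp add: K_def)
  have KA: "K * A = transpose_mat (transpose_mat A * H)"
    using A H by (simp add: K_def transpose_mult[of _ n m _ n])
  have "A * K * A = transpose_mat (transpose_mat A * H * transpose_mat A)"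
    using A H by (simp add: K_def transpose_mult[of _ n n _ m] transpose_mult[of _ n m _ m]
      transpose_mult[of _ m n _ m])
  then have AKA: "A * K * A = A"
    by (simp only: AHA transpose_transpose)
  define X where "X = K * A * G"
  have X: "X \<in> carrier_mat n m"
    using A G K by (simp add: X_def)
  \<comment> \<open>\<open>X\<close> shares its product \<open>A * X\<close> with \<open>G\<close>
    and its product \<open>X * A\<close> with \<open>K\<close>, and so inherits one symmetry
    condition from each.\<close>
  have "A * X = (A * K * A) * G"
    using A G K by (simp add: X_def assoc_mult_mat[of _ m n _ m _ m] assoc_mult_mat[of _ n m _ n _ m]
      assoc_mult_mat[of _ m n _ n _ m])
  then have AX: "A * X = A * G"
    by (simp only: AKA)
  have "X * A = K * (A * G * A)"
    using A G K by (simp add: X_def assoc_mult_mat[of _ n m _ n _ n] assoc_mult_mat[of _ n m _ m _ n]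
      assoc_mult_mat[of _ n n _ m _ n])
  then have XA: "X * A = K * A"
    by (simp only: AGA)
  have "X * A * X = K * (A * X)"
    unfolding XA using A X K by (simp add: assoc_mult_mat[of _ n m _ n _ m])
  also have "\<dots> = X"
    unfolding AX unfolding X_def using A G K by (simp add: assoc_mult_mat[of _ n m _ n _ m])
  finally have "X * A * X = X" .
  moreover have "A * X * A = A"
    by (simp only: AX AGA)
  moreover have "transpose_mat (A * X) = A * X"
    by (simp only: AX sym_AG)
  moreover have "transpose_mat (X * A) = X * A"
    by (simp only: XA KA sym_AH)
  ultimately show ?thesis
    using X unfolding is_pinv_def m_def n_def by blast
qed

text \<open>The symmetry conditions force \<open>A * X = A * Y\<close> and
  \<open>X * A = Y * A\<close>; then
  \<open>X = X * A * X = Y * A * X = Y * A * Y = Y\<close>.\<close>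

lemma is_pinv_unique:
  assumes "is_pinv A X" "is_pinv A Y"
  shows "X = Y"
proof -
  define m where "m = dim_row A"
  define n where "n = dim_col A"
  have A: "A \<in> carrier_mat m n"
    by (simp add: m_def n_def)
  have X: "X \<in> carrier_mat n m" and AXA: "A * X * A = A" and XAX: "X * A * X = X"
    and sym_AX: "transpose_mat (A * X) = A * X" and sym_XA: "transpose_mat (X * A) = X * A"
    using assms(1) by (simp_all add: is_pinv_def m_def n_def)
  have Y: "Y \<in> carrier_mat n m" and AYA: "A * Y * A = A" and YAY: "Y * A * Y = Y"
    and sym_AY: "transpose_mat (A * Y) = A * Y" and sym_YA: "transpose_mat (Y * A) = Y * A"
    using assms(2) by (simp_all add: is_pinv_def m_def n_def)
  \<comment> \<open>Transposing \<open>(A * Y) * (A * X)\<close> swaps its two symmetric factors,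
    after which \<open>A * X * A\<close> collapses to \<open>A\<close> and \<open>X\<close>
    disappears.\<close>
  have "A * X = transpose_mat ((A * Y * A) * X)"
    by (simp only: AYA sym_AX)
  also have "(A * Y * A) * X = (A * Y) * (A * X)"
    using A X Y by (intro assoc_mult_mat[of _ m m _ n _ m]) auto
  also have "transpose_mat \<dots> = (A * X) * (A * Y)"
    using A X Y by (subst transpose_mult[of _ m m _ m]) (auto simp: sym_AX sym_AY simp del: assoc_mult_mat)
  also have "\<dots> = (A * X * A) * Y"
    using A X Y by (intro assoc_mult_mat[of _ m m _ n _ m, symmetric]) auto
  finally have AX: "A * X = A * Y"
    by (simp only: AXA)
  have "X * A = transpose_mat (X * (A * Y * A))"
    by (simp only: AYA sym_XA)
  also have "X * (A * Y * A) = (X * A) * (Y * A)"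
    using A X Y by (simp add: assoc_mult_mat[of _ n m _ n _ n] assoc_mult_mat[of _ m n _ m _ n])
  also have "transpose_mat \<dots> = (Y * A) * (X * A)"
    using A X Y by (subst transpose_mult[of _ n n _ n]) (auto simp: sym_XA sym_YA simp del: assoc_mult_mat)
  also have "\<dots> = Y * (A * X * A)"
    using A X Y by (simp add: assoc_mult_mat[of _ n m _ n _ n] assoc_mult_mat[of _ m n _ m _ n])
  finally have XA: "X * A = Y * A"
    by (simp only: AXA)
  have "X = Y * A * X"
    by (simp only: XAX flip: XA)
  also have "\<dots> = Y * (A * X)"
    using A X Y by (intro assoc_mult_mat[of _ n m _ n _ m]) auto
  also have "\<dots> = Y * A * Y"
    unfolding AX using A Y by (intro assoc_mult_mat[of _ n m _ n _ m, symmetric]) auto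
  finally show ?thesis
    by (simp only: YAY)
qed

lemma is_pinv_pinv: "is_pinv A (pinv A)"
proof -
  obtain X where X: "is_pinv A X"
    using is_pinv_exists by blast
  show ?thesis
    unfolding pinv_def by (rule theI[where P = "is_pinv A", OF X is_pinv_unique[OF _ X]])
qed

lemma pinv_eqI: "is_pinv A X \<Longrightarrow> pinv A = X"
  by (rule is_pinv_unique[OF is_pinv_pinv])

lemma pinv_carrier: "A \<in> carrier_mat m n \<Longrightarrow> pinv A \<in> carrier_mat n m"
  using is_pinv_pinv[of A] by (auto simp: is_pinv_def)

section \<open>Pseudoinverses, gradients and Hessians under an isometric embedding\<close>

text \<open>With \<open>X = pinv A\<close>, the inner factors \<open>transpose_mat Q * Q\<close>
  cancel in one product and leave the symmetric \<open>A * X\<close>. The other product is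
  \<open>X * A\<close> between \<open>Q\<close> and \<open>transpose_mat Q\<close>, which is
  symmetric again.\<close>

lemma pinv_mult_transpose_isometry:
  assumes A: "A \<in> carrier_mat m d" and Q: "Q \<in> carrier_mat n d"
    and iso: "transpose_mat Q * Q = 1\<^sub>m d"
  shows "pinv (A * transpose_mat Q) = Q * pinv A"
proof (rule pinv_eqI)
  define X where "X = pinv A"
  define U where "U = transpose_mat Q"
  have X: "X \<in> carrier_mat d m" and U: "U \<in> carrier_mat d n"
    using A Q by (simp_all add: X_def U_def pinv_carrier)
  have AXA: "A * X * A = A" and XAX: "X * A * X = X"
    and sym_AX: "transpose_mat (A * X) = A * X" and sym_XA: "transpose_mat (X * A) = X * A"
    using is_pinv_pinv[of A] by (simp_all add: is_pinv_def X_def)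
  have UQ: "U * Q = 1\<^sub>m d"
    using iso by (simp add: U_def)
  have "(A * U) * (Q * X) = A * ((U * Q) * X)"
    using A Q U X by (simp add: assoc_mult_mat[of _ m d _ n _ m] assoc_mult_mat[of _ d n _ d _ m])
  then have 1: "(A * U) * (Q * X) = A * X"
    using X by (simp add: UQ)
  have 2: "(Q * X) * (A * U) = Q * ((X * A) * U)"
    using A Q U X by (simp add: assoc_mult_mat[of _ n d _ m _ n] assoc_mult_mat[of _ d m _ d _ n])
  have "transpose_mat ((X * A) * U) = Q * (X * A)"
    using A X U by (subst transpose_mult[of _ d d _ n]) (auto simp: sym_XA U_def simp del: assoc_mult_mat)
  then have "transpose_mat (Q * ((X * A) * U)) = Q * (X * A) * U"
    using A Q X U by (subst transpose_mult[of _ n d _ n]) (auto simp: U_def simp del: assoc_mult_mat)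
  also have "\<dots> = Q * ((X * A) * U)"
    using A Q X U by (intro assoc_mult_mat[of _ n d _ d _ n]) auto
  finally have 3: "transpose_mat ((Q * X) * (A * U)) = (Q * X) * (A * U)"
    unfolding 2 .
  have 4: "(A * U) * (Q * X) * (A * U) = A * U"
  proof -
    have "A * X * (A * U) = A * X * A * U"
      using A X U by (intro assoc_mult_mat[of _ m m _ d _ n, symmetric]) auto
    then show ?thesis
      by (simp only: 1 AXA)
  qed
  have 5: "(Q * X) * (A * U) * (Q * X) = Q * X"
  proof -
    have "(Q * X) * (A * U) * (Q * X) = (Q * X) * (A * X)"
      using A Q X U by (subst 1[symmetric], intro assoc_mult_mat[of _ n m _ n _ m]) auto
    also have "\<dots> = Q * (X * A * X)"
      using A Q X by (simp add: assoc_mult_mat[of _ n d _ m _ m] assoc_mult_mat[of _ d m _ d _ m])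
    finally show ?thesis
      by (simp only: XAX)
  qed
  show "is_pinv (A * transpose_mat Q) (Q * pinv A)"
    using A Q X 3 4 5 1 sym_AX
    unfolding is_pinv_def X_def[symmetric] U_def[symmetric]
    by (simp add: U_def del: assoc_mult_mat)
qed

text \<open>The vectors of function differences agree on both sides, so the factor \<open>Q\<close>
  comes from the pseudoinverse alone. The base point \<open>z\<close> is arbitrary because the
  Hessian also uses gradients at the shifted points \<open>z + col A i\<close>.\<close>

lemma simplex_gradient_isometry:
  assumes x0: "x0 \<in> carrier_vec n" and Q: "Q \<in> carrier_mat n d"
    and iso: "transpose_mat Q * Q = 1\<^sub>m d"
    and z: "z \<in> carrier_vec d" and A: "A \<in> carrier_mat d m"
    and g: "\<And>y. y \<in> carrier_vec d \<Longrightarrow> g y = f (x0 + Q *\<^sub>v y)"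
  shows "simplex_gradient f (x0 + Q *\<^sub>v z) (Q * A) = Q *\<^sub>v simplex_gradient g z A"
proof -
  have "pinv (transpose_mat (Q * A)) = Q * pinv (transpose_mat A)"
    using A Q iso by (subst transpose_mult) (auto intro: pinv_mult_transpose_isometry)
  moreover have "vec (dim_col (Q * A)) (\<lambda>j. f (x0 + Q *\<^sub>v z + col (Q * A) j) - f (x0 + Q *\<^sub>v z))
      = vec (dim_col A) (\<lambda>j. g (z + col A j) - g z)"
  proof (rule eq_vecI)
    fix j assume "j < dim_vec (vec (dim_col A) (\<lambda>j. g (z + col A j) - g z))"
    then have j: "j < m"
      using A by simp
    have c: "col A j \<in> carrier_vec d"
      using A by (metis carrier_matD(1) col_dim)
    have "x0 + Q *\<^sub>v z + col (Q * A) j = x0 + Q *\<^sub>v (z + col A j)"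
      unfolding col_mult2[OF Q A j] using x0 Q z c
      by (simp add: mult_add_distrib_mat_vec[of Q n d] assoc_add_vec[of _ n])
    then show "vec (dim_col (Q * A))
        (\<lambda>j. f (x0 + Q *\<^sub>v z + col (Q * A) j) - f (x0 + Q *\<^sub>v z)) $ j
      = vec (dim_col A) (\<lambda>j. g (z + col A j) - g z) $ j"
      using A Q z j c by (simp add: g)
  qed simp
  ultimately show ?thesis
    unfolding simplex_gradient_def
    using A Q pinv_carrier[of "transpose_mat A" m d]
    by (simp add: assoc_mult_mat_vec[of Q n d _ m])
qed

lemma simplex_gradient_carrier:
  "A \<in> carrier_mat k m \<Longrightarrow> simplex_gradient g z A \<in> carrier_vec k"
  using pinv_carrier[of "transpose_mat A" m k] by (simp add: simplex_gradient_def)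

text \<open>Each row is a difference of gradients multiplied by \<open>Q\<close> from the left; for
  gradients stored as rows this is multiplication by \<open>transpose_mat Q\<close> from the
  right.\<close>

lemma simplex_delta2_isometry:
  assumes x0: "x0 \<in> carrier_vec n" and Q: "Q \<in> carrier_mat n d"
    and iso: "transpose_mat Q * Q = 1\<^sub>m d"
    and z: "z \<in> carrier_vec d" and A: "A \<in> carrier_mat d p"
    and B: "\<And>i. i < p \<Longrightarrow> B i \<in> carrier_mat d (q i)"
    and C: "\<And>i. i < p \<Longrightarrow> C i = Q * B i"
    and g: "\<And>y. y \<in> carrier_vec d \<Longrightarrow> g y = f (x0 + Q *\<^sub>v y)"
  shows "simplex_delta2 f (x0 + Q *\<^sub>v z) (Q * A) C = simplex_delta2 g z A B * transpose_mat Q"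
proof (rule eq_rowI)
  fix i assume "i < dim_row (simplex_delta2 g z A B * transpose_mat Q)"
  then have i: "i < p"
    using A by (simp add: simplex_delta2_def)
  define u where "u = simplex_gradient g (z + col A i) (B i)"
  define v where "v = simplex_gradient g z (B i)"
  have uv: "u \<in> carrier_vec d" "v \<in> carrier_vec d"
    using simplex_gradient_carrier[OF B[OF i]] by (simp_all add: u_def v_def)
  have c: "col A i \<in> carrier_vec d"
    using A by (metis carrier_matD(1) col_dim)
  have "x0 + Q *\<^sub>v z + col (Q * A) i = x0 + Q *\<^sub>v (z + col A i)"
    unfolding col_mult2[OF Q A i] using x0 Q z c
    by (simp add: mult_add_distrib_mat_vec[of Q n d] assoc_add_vec[of _ n])
  then have grad: "simplex_gradient f (x0 + Q *\<^sub>v z + col (Q * A) i) (C i)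
      - simplex_gradient f (x0 + Q *\<^sub>v z) (C i) = Q *\<^sub>v u - Q *\<^sub>v v"
    using z c C[OF i] simplex_gradient_isometry[where g = g and f = f, OF x0 Q iso _ B[OF i] g]
    by (simp add: u_def v_def)
  have "row (simplex_delta2 f (x0 + Q *\<^sub>v z) (Q * A) C) i = Q *\<^sub>v u - Q *\<^sub>v v"
    using A Q uv i grad by (simp add: simplex_delta2_def)
  also have "\<dots> = Q *\<^sub>v (u - v)"
    using Q uv by (simp add: mult_minus_distrib_mat_vec[of Q n d])
  also have "u - v = row (simplex_delta2 g z A B) i"
    using A uv i by (simp add: simplex_delta2_def u_def v_def)
  \<comment> \<open>Entrywise both sides are scalar products of the same two vectors, in opposite
    order.\<close>
  also have "Q *\<^sub>v row (simplex_delta2 g z A B) i = row (simplex_delta2 g z A B * transpose_mat Q) i"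
    using A Q i by (intro eq_vecI)
      (auto simp: simplex_delta2_def intro: comm_scalar_prod[of _ d])
  finally show "row (simplex_delta2 f (x0 + Q *\<^sub>v z) (Q * A) C) i
    = row (simplex_delta2 g z A B * transpose_mat Q) i" .
qed (use A Q in \<open>simp_all add: simplex_delta2_def\<close>)

text \<open>The left factor \<open>Q\<close> comes from the pseudoinverse, the right factor
  \<open>transpose_mat Q\<close> from the second differences.\<close>

lemma simplex_hessian_isometry:
  assumes x0: "x0 \<in> carrier_vec n" and Q: "Q \<in> carrier_mat n d"
    and iso: "transpose_mat Q * Q = 1\<^sub>m d"
    and z: "z \<in> carrier_vec d" and A: "A \<in> carrier_mat d p"
    and B: "\<And>i. i < p \<Longrightarrow> B i \<in> carrier_mat d (q i)"
    and C: "\<And>i. i < p \<Longrightarrow> C i = Q * B i"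
    and g: "\<And>y. y \<in> carrier_vec d \<Longrightarrow> g y = f (x0 + Q *\<^sub>v y)"
  shows "simplex_hessian f (x0 + Q *\<^sub>v z) (Q * A) C
    = Q * simplex_hessian g z A B * transpose_mat Q"
proof -
  define P where "P = pinv (transpose_mat A)"
  define D where "D = simplex_delta2 g z A B"
  have P: "P \<in> carrier_mat d p" and D: "D \<in> carrier_mat p d"
    using A by (auto simp: P_def D_def simplex_delta2_def pinv_carrier)
  have "pinv (transpose_mat (Q * A)) = Q * P"
    using A Q iso unfolding P_def
    by (subst transpose_mult) (auto intro: pinv_mult_transpose_isometry)
  then have "simplex_hessian f (x0 + Q *\<^sub>v z) (Q * A) C = Q * P * (D * transpose_mat Q)"
    unfolding simplex_hessian_def D_def
    by (simp only: simplex_delta2_isometry[of x0 n Q d z A p B q C g f, OF assms])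
  also have "\<dots> = Q * (P * D) * transpose_mat Q"
    using Q P D by (simp add: assoc_mult_mat[of _ n d _ p _ n] assoc_mult_mat[of _ d p _ d _ n]
      assoc_mult_mat[of _ n d _ d _ n])
  finally show ?thesis
    by (simp add: simplex_hessian_def P_def D_def)
qed

section \<open>Reduced coordinates for the sample directions\<close>

text \<open>\<open>Q * transpose_mat Q\<close> fixes every vector of the form
  \<open>Q *\<^sub>v y\<close>. This gives the coordinate matrix explicitly, without choosing a
  \<open>y\<close> for each column.\<close>

lemma isometry_factor:
  fixes Q M :: "'a :: semiring_1 mat"
  assumes Q: "Q \<in> carrier_mat n d" and iso: "transpose_mat Q * Q = 1\<^sub>m d"
    and M: "M \<in> carrier_mat n p"
    and range: "\<And>j. j < p \<Longrightarrow> \<exists>y \<in> carrier_vec d. col M j = Q *\<^sub>v y"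
  shows "M = Q * (transpose_mat Q * M)"
proof (rule mat_col_eqI)
  fix j assume "j < dim_col (Q * (transpose_mat Q * M))"
  then have j: "j < p"
    using M by simp
  obtain y where y: "y \<in> carrier_vec d" and My: "col M j = Q *\<^sub>v y"
    using range[OF j] by blast
  have U: "transpose_mat Q \<in> carrier_mat d n" and UM: "transpose_mat Q * M \<in> carrier_mat d p"
    using Q M by auto
  have "col (Q * (transpose_mat Q * M)) j = Q *\<^sub>v (transpose_mat Q *\<^sub>v col M j)"
    by (simp only: col_mult2[OF Q UM j] col_mult2[OF U M j])
  also have "transpose_mat Q *\<^sub>v col M j = (transpose_mat Q * Q) *\<^sub>v y"
    unfolding My using Q y by (intro assoc_mult_mat_vec[symmetric]) auto
  finally show "col M j = col (Q * (transpose_mat Q * M)) j"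
    using y by (simp add: iso My)
qed (use M Q in auto)

theorem theorem5:
  fixes n d p :: nat
    and q :: "nat \<Rightarrow> nat"
    and f fhat :: "real vec \<Rightarrow> real"
    and x0 :: "real vec"
    and S Q :: "real mat"
    and T :: "nat \<Rightarrow> real mat"
    and Y :: "real vec set"
  assumes x0: "x0 \<in> carrier_vec n"
    and S: "S \<in> carrier_mat n p"
    and T: "\<And>i. i < p \<Longrightarrow> T i \<in> carrier_mat n (q i)"
    and Y: "Y = {x0} \<union> {x0 + col S i | i. i < p}
                \<union> {x0 + col (T i) j | i j. i < p \<and> j < q i}
                \<union> {x0 + col S i + col (T i) j | i j. i < p \<and> j < q i}"
    and d: "d < n"
    and Q: "Q \<in> carrier_mat n d"
    and orthonormal_cols:
      "\<And>i j. i < d \<Longrightarrow> j < d \<Longrightarrow> col Q i \<bullet> col Q j = (if i = j then 1 else 0)"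
    and Y_affine: "Y \<subseteq> {x0 + Q *\<^sub>v xhat | xhat. xhat \<in> carrier_vec d}"
    and fhat: "\<And>xhat. xhat \<in> carrier_vec d \<Longrightarrow> fhat xhat = f (x0 + Q *\<^sub>v xhat)"
  shows "\<exists>Shat That.
           Shat \<in> carrier_mat d p \<and> (\<forall>i<p. That i \<in> carrier_mat d (q i)) \<and>
           S = Q * Shat \<and> (\<forall>i<p. T i = Q * That i) \<and>
           simplex_hessian f x0 S T
             = Q * simplex_hessian fhat (0\<^sub>v d) Shat That * transpose_mat Q"
proof -
  have iso: "transpose_mat Q * Q = 1\<^sub>m d"
    using Q orthonormal_cols by (intro eq_matI) auto
  \<comment> \<open>Cancelling \<open>x0\<close> turns membership of a sample point in the affine
    space into membership of its displacement in the range of \<open>Q\<close>.\<close>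
  have range: "\<exists>y \<in> carrier_vec d. v = Q *\<^sub>v y"
    if in_Y: "x0 + v \<in> Y" and v: "v \<in> carrier_vec n" for v
  proof -
    obtain y where y: "y \<in> carrier_vec d" and eq: "x0 + v = x0 + Q *\<^sub>v y"
      using subsetD[OF Y_affine in_Y] by auto
    have "v = Q *\<^sub>v y"
    proof (rule eq_vecI)
      fix k assume "k < dim_vec (Q *\<^sub>v y)"
      then have k: "k < n"
        using Q by simp
      have "(x0 + v) $ k = (x0 + Q *\<^sub>v y) $ k"
        by (simp only: eq)
      then show "v $ k = (Q *\<^sub>v y) $ k"
        using k x0 Q v by simp
    qed (use v Q in simp)
    then show ?thesis
      using y by blast
  qed
  define Shat where "Shat = transpose_mat Q * S"
  define That where "That i = transpose_mat Q * T i" for i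
  have Shat: "Shat \<in> carrier_mat d p" and That: "\<And>i. i < p \<Longrightarrow> That i \<in> carrier_mat d (q i)"
    using Q S T by (auto simp: Shat_def That_def)
  have SQ: "S = Q * Shat"
    unfolding Shat_def
  proof (rule isometry_factor[OF Q iso S])
    fix j assume "j < p"
    then show "\<exists>y \<in> carrier_vec d. col S j = Q *\<^sub>v y"
      using S by (intro range) (auto simp: Y)
  qed
  have TQ: "T i = Q * That i" if i: "i < p" for i
    unfolding That_def
  proof (rule isometry_factor[OF Q iso T[OF i]])
    fix j assume "j < q i"
    then show "\<exists>y \<in> carrier_vec d. col (T i) j = Q *\<^sub>v y"
      using T[OF i] i by (intro range) (auto simp: Y)
  qed
  \<comment> \<open>The point \<open>x0\<close> has reduced coordinate zero, so the general Hessian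
    identity is taken at \<open>z = 0\<close>.\<close>
  have "x0 + Q *\<^sub>v 0\<^sub>v d = x0"
    using x0 Q by auto
  then have "simplex_hessian f x0 S T
      = Q * simplex_hessian fhat (0\<^sub>v d) Shat That * transpose_mat Q"
    using simplex_hessian_isometry[where f = f and g = fhat and C = T,
        OF x0 Q iso zero_carrier_vec Shat That TQ fhat]
    by (simp only: flip: SQ)
  with Shat That SQ TQ show ?thesis
    by (intro exI[of _ Shat] exI[of _ That] conjI allI impI)
qed

end
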